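(* Let $\theta_1,\theta_2$ be real numbers such that $1,\theta_1,\theta_2$ are linearly independent over $\mathbb{Z}$, and let $L(\mathbf{x})=x_0+x_1\theta_1+x_2\theta_2$. Let $P(\mathbf{x})=p_0x_0+p_1x_1+p_2x_2$ be a linear form with real coefficients such that the linear forms $L$ and $P$ are linearly independent (over $\mathbb{R}$). Let $\hat{\omega}=\hat{\omega}(\theta_1,\theta_2)$ be the uniform Diophantine exponent of $L$, and let $$ \omega_{LP}=\sup\left\{\gamma:\ \text{there exist infinitely many } \mathbf{x}\in\mathbb{Z}^3 \text{ such that } |L(\mathbf{x})|\le |P(\mathbf{x})|\cdot|\mathbf{x}|^{-\gamma}\right\}. $$ Then $$ \omega_{LP}\ \ge\ \hat{\omega}^2-\hat{\omega}+1 . $$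
   Context: For $\mathbf{z}=(z_0,z_1,z_2)\in\mathbb{R}^3$, $|\mathbf{z}|$ denotes the Euclidean length. For real $\theta_1,\theta_2$ with $1,\theta_1,\theta_2$ linearly independent over $\mathbb{Z}$ and $L(\mathbf{x})=x_0+x_1\theta_1+x_2\theta_2$, the uniform Diophantine exponent of $L$ is $$ \hat{\omega}=\hat{\omega}(\theta_1,\theta_2)=\sup\left\{\gamma:\ \limsup_{t\to\infty}\left(t^{\gamma}\min_{0<|\mathbf{x}|\le t}|L(\mathbf{x})|\right)<\infty\right\}, $$ where the minimum is over $\mathbf{x}=(x_0,x_1,x_2)\in\mathbb{Z}^3$. Suprema over real $\gamma$ are taken in the extended reals (the value $+\infty$ is allowed, and if $\hat\omega=+\infty$ then $\hat\omega^2-\hat\omega+1$ is read as $+\infty$). In the definition of $\omega_{LP}$ only nonzero $\mathbf{x}$ are considered. *)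

theory Defs
  imports "HOL-Analysis.Analysis"
begin

text \<open>
  The coordinates $x_0, x_1, x_2$ of a vector are the components 1, 2, 3 of an element of
  \<^typ>\<open>real^3\<close>, whose \<^const>\<open>norm\<close> is the Euclidean length.
\<close>

definition int_points :: "(real^3) set" where
  "int_points = {x. \<forall>i. x $ i \<in> \<int>}"

definition lin_form :: "real \<Rightarrow> real \<Rightarrow> real \<Rightarrow> real^3 \<Rightarrow> real" where
  "lin_form a\<^sub>0 a\<^sub>1 a\<^sub>2 x = a\<^sub>0 * x $ 1 + a\<^sub>1 * x $ 2 + a\<^sub>2 * x $ 3"

definition lin_indep_forms :: "(real^3 \<Rightarrow> real) \<Rightarrow> (real^3 \<Rightarrow> real) \<Rightarrow> bool" where
  "lin_indep_forms F G \<longleftrightarrow>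
     (\<forall>a b :: real. (\<forall>x. a * F x + b * G x = 0) \<longrightarrow> a = 0 \<and> b = 0)"

definition lin_indep_int3 :: "real \<Rightarrow> real \<Rightarrow> real \<Rightarrow> bool" where
  "lin_indep_int3 u v w \<longleftrightarrow>
     (\<forall>a b c :: int. of_int a * u + of_int b * v + of_int c * w = 0 \<longrightarrow> a = 0 \<and> b = 0 \<and> c = 0)"

text \<open>
  The minimum is over a finite set, which is nonempty for \<open>t \<ge> 1\<close>; smaller \<open>t\<close> do not
  affect the limit superior.
\<close>

definition min_form :: "(real^3 \<Rightarrow> real) \<Rightarrow> real \<Rightarrow> real" where
  "min_form F t = Min ((\<lambda>x. \<bar>F x\<bar>) ` {x \<in> int_points. 0 < norm x \<and> norm x \<le> t})"

definition uniform_exponent :: "real \<Rightarrow> real \<Rightarrow> ereal" where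
  "uniform_exponent \<theta>\<^sub>1 \<theta>\<^sub>2 =
     Sup (ereal ` {\<gamma> :: real.
       Limsup at_top (\<lambda>t :: real. ereal (t powr \<gamma> * min_form (lin_form 1 \<theta>\<^sub>1 \<theta>\<^sub>2) t)) < \<infinity>})"

definition omega_LP :: "(real^3 \<Rightarrow> real) \<Rightarrow> (real^3 \<Rightarrow> real) \<Rightarrow> ereal" where
  "omega_LP L P =
     Sup (ereal ` {\<gamma> :: real.
       infinite {x \<in> int_points. x \<noteq> 0 \<and> \<bar>L x\<bar> \<le> \<bar>P x\<bar> * norm x powr (- \<gamma>)}})"

end

(*
  Let x_0, x_1, ... be the minimal points of L, with X_n = |x_n| and l_n = |L(x_n)|; every admissible
  exponent \<gamma> gives l_n \<le> C X_{n+1}^{-\<gamma>}.  Suppose |P(x)| < |L(x)| |x|^g for all large integer points x,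
  where g < \<gamma>^2 - \<gamma> + 1.  Call n special if x_n, x_{n+1}, x_{n+2} are linearly independent.  Their
  determinant is a nonzero integer and, expanded along L, P and a coordinate, is dominated by the terms
  containing P(x_{n+2}), so |P(x_{n+2})| is bounded below by a multiple of 1 / (l_n X_{n+1}) and
  the minor L(x_{n+1}) P(x_{n+2}) - L(x_{n+2}) P(x_{n+1}) by a multiple of l_{n+1} / (l_n X_{n+1}).
  Consecutive minimal points are a basis of the integer points in the plane they span, so these
  minors do not shrink until the next special index k, where the minor is at most
  2 l_k l_{k+1} X_{k+1}^g.  The two bounds force ln (l_n / l_{n+1}) - \<gamma> (\<gamma> - 2) ln X_{n+1} to tend to
  minus infinity along the special n, although it is bounded below there.
*)

theory Submission
  imports Defs
begin

section \<open>Descent argument for real sequences\<close>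

section \<open>Growth of minors and determinants\<close>

lemma descent_contradiction:
  fixes G :: "nat \<Rightarrow> real"
  assumes "S n0" and step: "\<And>n. S n \<Longrightarrow> \<exists>k. S k \<and> G k \<le> G n - 1"
    and lower: "\<And>n. S n \<Longrightarrow> G n \<ge> B"
  shows False
proof -
  have "\<exists>k. S k \<and> G k \<le> G n0 - real m" for m
  proof (induction m)
    case 0
    then show ?case using assms(1) by auto
  next
    case (Suc m)
    then obtain k where "S k" "G k \<le> G n0 - real m" by blast
    moreover obtain j where "S j" "G j \<le> G k - 1" using step[OF \<open>S k\<close>] by blast
    ultimately show ?case by (intro exI[of _ j]) auto
  qed
  \<comment> \<open>One drop more than the ceiling of \<open>G n0 - B\<close> carries
    \<open>G k\<close> below \<open>B\<close>.\<close>
  then obtain k where "S k" "G k \<le> G n0 - real (nat \<lceil>G n0 - B\<rceil> + 1)" by blast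
  with lower[OF \<open>S k\<close>] show False by linarith
qed

text \<open>The analytic half, freed of geometry. In the application \<open>X\<close>,
  \<open>l\<close> and \<open>p\<close> are the norms and the absolute values of L and P at the
  minimal points, \<open>m\<close> is the absolute minor of L and P at two neighbours, and
  \<open>S\<close> marks linearly independent triples. In logarithmic scale every estimate becomes
  linear in \<open>a\<close> and \<open>v\<close>.\<close>

lemma large_determinants_contradiction:
  fixes X l p m :: "nat \<Rightarrow> real" and S :: "nat \<Rightarrow> bool" and \<gamma> g C K B :: real
  assumes X1: "\<And>n. 1 \<le> X n" and Xmono: "\<And>n. X n < X (Suc n)"
    and Xlim: "filterlim X at_top sequentially"
    and lpos: "\<And>n. 0 < l n" and lmono: "\<And>n. l (Suc n) < l n"
    and C: "0 < C" and K: "0 < K" and B: "0 < B" and \<gamma>: "1 < \<gamma>" and g: "0 \<le> g" "g < \<gamma>\<^sup>2 - \<gamma> + 1"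
    and unif: "\<forall>\<^sub>F n in sequentially. l n \<le> C * X (Suc n) powr (- \<gamma>)"
    and p0: "\<And>n. 0 \<le> p n" and pB: "\<And>n. p n \<le> B * X n"
    and small: "\<forall>\<^sub>F n in sequentially. p n \<le> l n * X n powr g"
    and Sinf: "\<And>N. \<exists>n\<ge>N. S n"
    and S: "\<And>n. S n \<Longrightarrow> 1 \<le> K * (l n * (p (n+1) * X (n+2) + p (n+2) * X (n+1))
              + l (n+1) * (p n * X (n+2) + p (n+2) * X n)
              + l (n+2) * (p n * X (n+1) + p (n+1) * X n))"
    and m_lower: "\<And>n. l n * p (n+1) - l (n+1) * p n \<le> m n"
    and m_upper: "\<And>n. m n \<le> l n * p (n+1) + l (n+1) * p n"
    and m_mono: "\<And>n. \<not> S n \<Longrightarrow> m n \<le> m (Suc n)"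
  shows False
proof -
  have Xpos: "0 < X n" for n using X1[of n] by linarith
  have Xm: "i \<le> j \<Longrightarrow> X i \<le> X j" for i j
    using lift_Suc_mono_le[of X i j] Xmono by (meson less_imp_le)
  have lm: "i \<le> j \<Longrightarrow> l j \<le> l i" for i j
    using lift_Suc_antimono_le[of l i j] lmono by (meson less_imp_le)
  define \<delta> where "\<delta> = \<gamma>\<^sup>2 - \<gamma> + 1 - g"
  have \<delta>: "0 < \<delta>" using g by (simp add: \<delta>_def)
  \<comment> \<open>The index is shifted because the uniform bound ties \<open>l n\<close> to
    \<open>X (Suc n)\<close>.\<close>
  define a where "a n = ln (X (Suc n))" for n
  define v where "v n = ln (l n)" for n
  define c where "c = ln C"
  \<comment> \<open>The determinant bound has six products, each at most
    \<open>B * l n * X (n+1) * X (n+2)\<close>.\<close>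
  define d where "d = ln (6 * K * B)"
  obtain N1 where unif1: "\<And>n. n \<ge> N1 \<Longrightarrow> l n \<le> C * X (Suc n) powr (- \<gamma>)"
    using unif unfolding eventually_sequentially by blast
  obtain N2 where small1: "\<And>n. n \<ge> N2 \<Longrightarrow> p n \<le> l n * X n powr g"
    using small unfolding eventually_sequentially by blast
  have a_mono: "i \<le> j \<Longrightarrow> a i \<le> a j" for i j
    unfolding a_def using Xm[of "Suc i" "Suc j"] Xpos by simp
  have a0: "0 \<le> a n" for n
    unfolding a_def using X1 by simp
  have v_le: "v n \<le> c - \<gamma> * a n" if "n \<ge> N1" for n
  proof -
    have "v n \<le> ln (C * X (Suc n) powr (- \<gamma>))"
      unfolding v_def using unif1[OF that] lpos[of n] by (rule ln_mono)
    also have "\<dots> = c - \<gamma> * a n"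
      using C Xpos[of "Suc n"] by (simp add: ln_mult ln_powr c_def a_def)
    finally show ?thesis .
  qed
  have next_large: "0 \<le> d + v n + a n + a (Suc n)" if "S n" for n
  proof -
    let ?Z = "l n * X (n+1) * X (n+2)"
    have bnd: "l i * (p j * X k) \<le> B * ?Z" if "n \<le> i" "X j * X k \<le> X (n+1) * X (n+2)" for i j k
    proof -
      have "l i * (p j * X k) \<le> l n * ((B * X j) * X k)"
        using lm[OF that(1)] pB[of j] p0[of j] Xpos[of k] lpos[of n] lpos[of i]
        by (intro mult_mono mult_right_mono) auto
      also have "\<dots> = B * (l n * (X j * X k))" by simp
      also have "\<dots> \<le> B * (l n * (X (n+1) * X (n+2)))"
        using B lpos[of n] that(2) by (intro mult_left_mono) auto
      finally show ?thesis by (simp add: mult.assoc)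
    qed
    have XX: "X n * X (n+2) \<le> X (n+1) * X (n+2)" "X n * X (n+1) \<le> X (n+1) * X (n+2)"
      using Xpos[of n] Xpos[of "n+1"] Xpos[of "n+2"] Xm[of n "n+1"] Xm[of "n+1" "n+2"] Xm[of n "n+2"]
      by (auto intro!: mult_right_mono simp: mult.commute mult_left_mono)
    have "l n * (p (n+1) * X (n+2) + p (n+2) * X (n+1))
              + l (n+1) * (p n * X (n+2) + p (n+2) * X n)
              + l (n+2) * (p n * X (n+1) + p (n+1) * X n) \<le> 6 * (B * ?Z)"
      using bnd[of n "n+1" "n+2"] bnd[of n "n+2" "n+1"] bnd[of "n+1" n "n+2"] bnd[of "n+1" "n+2" n]
        bnd[of "n+2" n "n+1"] bnd[of "n+2" "n+1" n] XX
      by (simp add: distrib_left mult.commute)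
    from mult_left_mono[OF this, of K] S[OF that] K have "1 \<le> K * (6 * (B * ?Z))" by linarith
    then have "1 \<le> (6 * K * B) * ?Z" by (simp add: mult_ac)
    then have "0 \<le> ln ((6 * K * B) * ?Z)" by simp
    also have "\<dots> = d + v n + a n + a (Suc n)"
      using K B lpos[of n] Xpos[of "n+1"] Xpos[of "n+2"]
      by (simp add: ln_mult d_def v_def a_def)
    finally show ?thesis .
  qed
  \<comment> \<open>Since \<open>X (n+2)\<close> is at least a multiple of
    \<open>1 / (l n * X (n+1))\<close> and \<open>l n\<close> is small, the norm grows at special
    indices with exponent \<gamma> - 1.\<close>
  have a_step: "(\<gamma> - 1) * a n - c - d \<le> a (Suc n)" if "S n" "n \<ge> N1" for n
    using next_large[OF that(1)] v_le[OF that(2)] by (simp add: algebra_simps)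
  text \<open>The quantity estimated here bounds the determinant terms without \<open>p (n + 2)\<close>.\<close>
  have U_ln: "ln (l n * l (n+1) * X (n+1) powr g * X (n+2)) \<le> 2 * c + (\<gamma> - 1) * (c + d) - \<delta> * a n"
    if "S n" "n \<ge> N1" for n
  proof -
    have "ln (l n * l (n+1) * X (n+1) powr g * X (n+2)) = v n + v (n+1) + g * a n + a (Suc n)"
      using lpos[of n] lpos[of "n+1"] Xpos[of "n+1"] Xpos[of "n+2"]
      by (simp add: ln_mult ln_powr v_def a_def)
    also have "\<dots> \<le> 2 * c + (g - \<gamma>) * a n - (\<gamma> - 1) * a (Suc n)"
      using v_le[of n] v_le[of "n+1"] that by (simp add: algebra_simps)
    also have "\<dots> \<le> 2 * c + (g - \<gamma>) * a n - (\<gamma> - 1) * ((\<gamma> - 1) * a n - c - d)"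
      using mult_left_mono[OF a_step[OF that], of "\<gamma> - 1"] \<gamma> by simp
    \<comment> \<open>The coefficient of \<open>a n\<close> is g - \<gamma> - (\<gamma> - 1)^2,
      which equals - \<delta>; this is one of the two places where the threshold \<gamma>^2 -
      \<gamma> + 1 arises.\<close>
    also have "\<dots> = 2 * c + (\<gamma> - 1) * (c + d) - \<delta> * a n"
      by (simp add: \<delta>_def algebra_simps power2_eq_square)
    finally show ?thesis .
  qed
  have a_lim: "filterlim a at_top sequentially"
    unfolding a_def by (rule filterlim_compose[OF ln_at_top])
      (use Xlim in \<open>simp add: filterlim_sequentially_Suc\<close>)
  have a_large: "\<exists>N. \<forall>n\<ge>N. R \<le> a n" for R
    using a_lim unfolding filterlim_at_top eventually_sequentially by blast
  \<comment> \<open>Small enough for two purposes: four terms of size \<epsilon> use up only a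
    quarter of \<open>1 / K\<close>, and \<open>2 * \<epsilon>\<close> stays below the lower bound
    \<open>1 / (4 * K)\<close> found for \<open>T\<close>.\<close>
  define \<epsilon> where "\<epsilon> = 1 / (16 * K)"
  have \<epsilon>: "0 < \<epsilon>" using K by (simp add: \<epsilon>_def)
  obtain N3 where N3: "\<And>n. n \<ge> N3 \<Longrightarrow> (2 * c + (\<gamma> - 1) * (c + d) - ln \<epsilon>) / \<delta> \<le> a n"
    using a_large by blast
  have U: "l n * l (n+1) * X (n+1) powr g * X (n+2) \<le> \<epsilon>" if "S n" "n \<ge> N1" "n \<ge> N3" for n
  proof -
    have "2 * c + (\<gamma> - 1) * (c + d) - ln \<epsilon> \<le> \<delta> * a n"
      using N3[OF that(3)] \<delta> by (simp add: pos_divide_le_eq mult.commute)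
    with U_ln[OF that(1,2)] have "ln (l n * l (n+1) * X (n+1) powr g * X (n+2)) \<le> ln \<epsilon>" by linarith
    then show ?thesis
      using \<epsilon> lpos[of n] lpos[of "n+1"] Xpos[of "n+1"] Xpos[of "n+2"] by (subst (asm) ln_le_cancel_iff) auto
  qed
  define N where "N = max N1 (max N2 N3)"
  \<comment> \<open>Only the two terms with \<open>p (n+2)\<close> can carry the determinant, so
    \<open>p (n+2)\<close> is large. Then \<open>half\<close> ensures that the second product in the
    minor cancels at most half of the first.\<close>
  have main: "l (n+1) / (8 * K * l n * X (n+1)) \<le> m (n+1)" if Sn: "S n" and nN: "n \<ge> N" for n
  proof -
    have T1: "l n * (p (n+1) * X (n+2)) \<le> \<epsilon>"
    proof -
      have "l n * (p (n+1) * X (n+2)) \<le> l n * ((l (n+1) * X (n+1) powr g) * X (n+2))"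
        using small1[of "n+1"] nN lpos[of n] Xpos[of "n+2"]
        by (intro mult_left_mono mult_right_mono) (auto simp: N_def)
      also have "\<dots> \<le> \<epsilon>" using U[OF Sn] nN by (simp add: N_def mult.assoc)
      finally show ?thesis .
    qed
    have T3: "l (n+1) * (p n * X (n+2)) \<le> \<epsilon>"
    proof -
      have "p n \<le> l n * X (n+1) powr g"
      proof -
        have "p n \<le> l n * X n powr g" using small1[of n] nN by (simp add: N_def)
        also have "\<dots> \<le> l n * X (n+1) powr g"
          using lpos[of n] Xpos[of n] Xm[of n "n+1"] g by (intro mult_left_mono powr_mono2) auto
        finally show ?thesis .
      qed
      then have "l (n+1) * (p n * X (n+2)) \<le> l (n+1) * ((l n * X (n+1) powr g) * X (n+2))"
        using lpos[of "n+1"] Xpos[of "n+2"]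
        by (intro mult_left_mono mult_right_mono) auto
      also have "\<dots> \<le> \<epsilon>" using U[OF Sn] nN by (simp add: N_def mult_ac)
      finally show ?thesis .
    qed
    define T where "T = l n * (p (n+2) * X (n+1))"
    \<comment> \<open>Since \<open>l\<close> decreases and \<open>X\<close> increases, the three
      remaining terms are dominated by \<open>T\<close> and by the terms of \<open>T1\<close> and
      \<open>T3\<close>.\<close>
    have R2: "l (n+1) * (p (n+2) * X n) \<le> T"
      unfolding T_def using lm[of n "n+1"] Xm[of n "n+1"] p0[of "n+2"] lpos[of n] Xpos[of n]
      by (intro mult_mono mult_left_mono) auto
    have R1: "l (n+2) * (p (n+1) * X n) \<le> l n * (p (n+1) * X (n+2))"
      using lm[of n "n+2"] Xm[of n "n+2"] p0[of "n+1"] lpos[of n] Xpos[of n]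
      by (intro mult_mono mult_left_mono) auto
    have R3: "l (n+2) * (p n * X (n+1)) \<le> l (n+1) * (p n * X (n+2))"
      using lm[of "n+1" "n+2"] Xm[of "n+1" "n+2"] p0[of n] lpos[of "n+1"] Xpos[of "n+1"]
      by (intro mult_mono mult_left_mono) auto
    have "l n * (p (n+1) * X (n+2) + p (n+2) * X (n+1))
              + l (n+1) * (p n * X (n+2) + p (n+2) * X n)
              + l (n+2) * (p n * X (n+1) + p (n+1) * X n) \<le> 4 * \<epsilon> + 2 * T"
      using T1 T3 R1 R2 R3 unfolding T_def distrib_left by linarith
    from mult_left_mono[OF this, of K] S[OF Sn] K have "1 \<le> K * (4 * \<epsilon> + 2 * T)" by linarith
    then have T: "1 / (4 * K) \<le> T"
      using K by (simp add: \<epsilon>_def field_simps)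
    have half: "p (n+1) \<le> p (n+2) / 2"
    proof (rule ccontr)
      assume "\<not> p (n+1) \<le> p (n+2) / 2"
      then have "T \<le> 2 * (l n * (p (n+1) * X (n+2)))"
        unfolding T_def using Xm[of "n+1" "n+2"] lpos[of n] Xpos[of "n+1"] p0[of "n+1"]
          mult_mono[of "p (n+2)" "2 * p (n+1)" "X (n+1)" "X (n+2)"]
          mult_left_mono[of "p (n+2) * X (n+1)" "2 * p (n+1) * X (n+2)" "l n"]
        by simp
      then have "T \<le> 2 * \<epsilon>" using T1 by linarith
      with T K show False by (simp add: \<epsilon>_def field_simps)
    qed
    have "l (n+2) * p (n+1) \<le> l (n+1) * (p (n+2) / 2)"
      using half lm[of "n+1" "n+2"] p0[of "n+1"] lpos[of "n+1"] by (intro mult_mono) auto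
    with m_lower[of "n+1"] have mm: "l (n+1) * p (n+2) / 2 \<le> m (n+1)" by simp
    have "1 / (4 * K * l n * X (n+1)) \<le> p (n+2)"
      using T K lpos[of n] Xpos[of "n+1"] by (simp add: T_def field_simps)
    then have "l (n+1) * (1 / (4 * K * l n * X (n+1))) / 2 \<le> l (n+1) * p (n+2) / 2"
      using lpos[of "n+1"] by (intro divide_right_mono mult_left_mono) auto
    with mm show ?thesis by (simp add: mult_ac)
  qed
  have m_le: "m k \<le> 2 * l k * l (k+1) * X (k+1) powr g" if "k \<ge> N" for k
  proof -
    have 1: "l k * p (k+1) \<le> l k * (l (k+1) * X (k+1) powr g)"
      using small1[of "k+1"] that lpos[of k] by (intro mult_left_mono) (auto simp: N_def)
    have "p k \<le> l k * X (k+1) powr g"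
    proof -
      have "p k \<le> l k * X k powr g" using small1[of k] that by (simp add: N_def)
      also have "\<dots> \<le> l k * X (k+1) powr g"
        using lpos[of k] Xpos[of k] Xm[of k "k+1"] g by (intro mult_left_mono powr_mono2) auto
      finally show ?thesis .
    qed
    then have "l (k+1) * p k \<le> l (k+1) * (l k * X (k+1) powr g)"
      using lpos[of "k+1"] by (intro mult_left_mono) auto
    with 1 m_upper[of k] show ?thesis by (simp add: algebra_simps)
  qed
  \<comment> \<open>The weight \<gamma> * (\<gamma> - 2) is (\<gamma> - 1)^2 - 1. In
    \<open>descend\<close> it turns the term \<open>a n\<close> into (\<gamma> - 1)^2 times
    \<open>a n\<close>, which \<open>a_step\<close> bounds by a multiple of \<open>a k\<close>; the
    total coefficient of \<open>a k\<close> is then - \<delta>. The same weight is what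
    \<open>lower\<close> yields.\<close>
  define G where "G n = v n - v (n+1) - \<gamma> * (\<gamma> - 2) * a n" for n
  define c' where "c' = ln (16 * K) + 2 * c + (\<gamma> - 1) * (c + d)"
  have lower: "- (c + \<gamma> * d) - (\<gamma> - 1) * c \<le> G n" if "S n" "n \<ge> N" for n
  proof -
    have nN: "n \<ge> N1" using that(2) by (simp add: N_def)
    have "v (n+1) \<le> c - \<gamma> * a (Suc n)" using v_le[of "n+1"] nN by simp
    also have "\<dots> \<le> c + \<gamma> * (d + v n + a n)"
      using mult_left_mono[OF next_large[OF that(1)], of \<gamma>] \<gamma> by (simp add: algebra_simps)
    finally have 1: "v (n+1) \<le> c + \<gamma> * (d + v n + a n)" .
    have "(\<gamma> - 1) * v n \<le> (\<gamma> - 1) * (c - \<gamma> * a n)"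
      using v_le[OF nN] \<gamma> by (intro mult_left_mono) auto
    with 1 show ?thesis unfolding G_def by (simp add: algebra_simps)
  qed
  have descend: "G k \<le> G n + c' - \<delta> * a k"
    if Sn: "S n" and Sk: "S k" and nN: "n \<ge> N" and nk: "n < k" and gap: "\<And>j. n < j \<Longrightarrow> j < k \<Longrightarrow> \<not> S j" for n k
  proof -
    \<comment> \<open>No index strictly between \<open>n\<close> and \<open>k\<close> is special, so
      the minor does not decrease from \<open>n+1\<close> to \<open>k\<close>. There its lower bound
      from \<open>main\<close> meets the upper bound from \<open>m_le\<close>.\<close>
    have "Suc n \<le> j \<Longrightarrow> j \<le> k \<Longrightarrow> m (Suc n) \<le> m j" for j
    proof (induction j rule: dec_induct)
      case (step i)
      then show ?case using m_mono[of i] gap[of i] by fastforce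
    qed simp
    then have "m (n+1) \<le> m k" using nk by simp
    with main[OF Sn nN] m_le[of k] nk nN
    have "l (n+1) / (8 * K * l n * X (n+1)) \<le> 2 * l k * l (k+1) * X (k+1) powr g" by linarith
    then have "l (n+1) \<le> (2 * l k * l (k+1) * X (k+1) powr g) * (8 * K * l n * X (n+1))"
      using K lpos[of n] Xpos[of "n+1"] by (subst (asm) pos_divide_le_eq) auto
    then have "l (n+1) \<le> (16 * K) * l n * X (n+1) * l k * l (k+1) * X (k+1) powr g"
      by (simp add: mult_ac)
    then have "v (n+1) \<le> ln ((16 * K) * l n * X (n+1) * l k * l (k+1) * X (k+1) powr g)"
      unfolding v_def using lpos[of "n+1"] by (rule ln_mono)
    also have "\<dots> = ln (16 * K) + v n + a n + v k + v (k+1) + g * a k"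
      using K lpos[of n] lpos[of k] lpos[of "k+1"] Xpos[of "n+1"] Xpos[of "k+1"]
      by (simp add: ln_mult ln_powr v_def a_def)
    finally have 1: "v k - v (k+1) \<le> ln (16 * K) + (v n - v (n+1)) + a n + 2 * v k + g * a k" by simp
    have 2: "v k \<le> c - \<gamma> * a k" using v_le[of k] nk nN by (simp add: N_def)
    have "(\<gamma> - 1) * a n - c - d \<le> a k"
      using a_step[OF Sn] nN a_mono[of "Suc n" k] nk by (simp add: N_def)
    then have "(\<gamma> - 1) * ((\<gamma> - 1) * a n - c - d) \<le> (\<gamma> - 1) * a k"
      using \<gamma> by (intro mult_left_mono) auto
    with 1 2 show ?thesis
      unfolding G_def c'_def \<delta>_def by (simp add: algebra_simps power2_eq_square)
  qed
  \<comment> \<open>From here on \<delta> times \<open>a k\<close> exceeds \<open>c'\<close> by at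
    least 1, so each passage to the next special index lowers \<open>G\<close> by at least
    1.\<close>
  obtain N4 where N4: "\<And>n. n \<ge> N4 \<Longrightarrow> (c' + 1) / \<delta> \<le> a n"
    using a_large by blast
  define M where "M = max N N4"
  obtain n0 where n0: "n0 \<ge> M" "S n0" using Sinf by blast
  show False
  proof (rule descent_contradiction[of "\<lambda>n. S n \<and> n \<ge> M" n0 G])
    show "S n0 \<and> n0 \<ge> M" using n0 by simp
    show "- (c + \<gamma> * d) - (\<gamma> - 1) * c \<le> G n" if "S n \<and> n \<ge> M" for n
      using lower[of n] that by (simp add: M_def)
    show "\<exists>k. (S k \<and> k \<ge> M) \<and> G k \<le> G n - 1" if n: "S n \<and> n \<ge> M" for n
    proof -
      define k where "k = (LEAST k. Suc n \<le> k \<and> S k)"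
      have k: "Suc n \<le> k \<and> S k"
        unfolding k_def using Sinf[of "Suc n"] by (rule LeastI_ex[of "\<lambda>k. Suc n \<le> k \<and> S k"])
      have gap: "\<not> S j" if "n < j" "j < k" for j
        using not_less_Least[of j "\<lambda>k. Suc n \<le> k \<and> S k"] that unfolding k_def by auto
      have "c' + 1 \<le> \<delta> * a k"
        using N4[of k] k n \<delta> by (simp add: M_def pos_divide_le_eq mult.commute)
      moreover have "G k \<le> G n + c' - \<delta> * a k"
        using descend[of n k] k n gap by (auto simp: M_def)
      ultimately show ?thesis using k n by (intro exI[of _ k]) auto
    qed
  qed
qed

section \<open>Integer lattice and geometry of minimal points\<close>

section \<open>Integer points and minimal points\<close>

lemma int_points_add: "x \<in> int_points \<Longrightarrow> y \<in> int_points \<Longrightarrow> x + y \<in> int_points"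
  by (simp add: int_points_def)

lemma int_points_diff: "x \<in> int_points \<Longrightarrow> y \<in> int_points \<Longrightarrow> x - y \<in> int_points"
  by (simp add: int_points_def)

lemma int_points_scaleR: "c \<in> \<int> \<Longrightarrow> x \<in> int_points \<Longrightarrow> c *\<^sub>R x \<in> int_points"
  by (simp add: int_points_def)

lemma inner_int_points: "x \<in> int_points \<Longrightarrow> y \<in> int_points \<Longrightarrow> x \<bullet> y \<in> \<int>"
  by (simp add: int_points_def inner_vec_def sum_3)

lemma cross3_int_points: "x \<in> int_points \<Longrightarrow> y \<in> int_points \<Longrightarrow> cross3 x y \<in> int_points"
  by (simp add: int_points_def forall_3 cross3_def)

lemma Ints_abs_ge_1: "x \<in> \<int> \<Longrightarrow> x \<noteq> 0 \<Longrightarrow> 1 \<le> \<bar>x\<bar>" for x :: real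
  by (auto elim!: Ints_cases)

lemma norm_int_points_ge_1:
  assumes "x \<in> int_points" "x \<noteq> 0"
  shows "1 \<le> norm x"
proof -
  have "1 \<le> \<bar>x \<bullet> x\<bar>"
    using assms by (intro Ints_abs_ge_1 inner_int_points) auto
  then have "1\<^sup>2 \<le> (norm x)\<^sup>2" by (simp add: dot_square_norm)
  then show ?thesis by (rule power2_le_imp_le) simp
qed

lemma finite_int_points_le: "finite {x \<in> int_points. norm x \<le> r}"
proof -
  let ?I = "{- \<lceil>r\<rceil>..\<lceil>r\<rceil>}"
  have "{x \<in> int_points. norm x \<le> r} \<subseteq>
      (\<lambda>(a, b, c). vector [real_of_int a, real_of_int b, real_of_int c]) ` (?I \<times> ?I \<times> ?I)"
  proof
    fix x :: "real^3" assume x: "x \<in> {x \<in> int_points. norm x \<le> r}"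
    have I: "\<lfloor>x $ i\<rfloor> \<in> ?I" "of_int \<lfloor>x $ i\<rfloor> = x $ i" for i
    proof -
      show eq: "of_int \<lfloor>x $ i\<rfloor> = x $ i"
        using x by (auto simp: int_points_def elim: Ints_cases)
      have "\<bar>x $ i\<bar> \<le> r"
        using x component_le_norm_cart[of x i] by simp
      then show "\<lfloor>x $ i\<rfloor> \<in> ?I"
        using eq by (simp add: abs_le_iff) linarith
    qed
    have "x = vector [of_int \<lfloor>x $ 1\<rfloor>, of_int \<lfloor>x $ 2\<rfloor>, of_int \<lfloor>x $ 3\<rfloor>]"
      by (simp add: vec_eq_iff forall_3 I(2))
    then show "x \<in> (\<lambda>(a, b, c). vector [real_of_int a, real_of_int b, real_of_int c]) ` (?I \<times> ?I \<times> ?I)"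
      using I(1) by (intro image_eqI[of _ _ "(\<lfloor>x $ 1\<rfloor>, \<lfloor>x $ 2\<rfloor>, \<lfloor>x $ 3\<rfloor>)"]) auto
  qed
  then show ?thesis
    by (rule finite_subset) auto
qed

text \<open>Here \<open>y\<close> has least norm among the nonzero integer points with a value of
  \<open>F\<close> smaller than at \<open>x\<close>. As \<open>norm x < norm y\<close>, the last
  clause also makes \<open>x\<close> minimal within its own closed ball, and \<open>y\<close> is
  automatically nonzero.\<close>

definition consecutive :: "(real^3 \<Rightarrow> real) \<Rightarrow> real^3 \<Rightarrow> real^3 \<Rightarrow> bool" where
  "consecutive F x y \<longleftrightarrow> x \<in> int_points \<and> x \<noteq> 0 \<and> y \<in> int_points \<and>
     norm x < norm y \<and> \<bar>F y\<bar> < \<bar>F x\<bar> \<and>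
     (\<forall>z\<in>int_points. z \<noteq> 0 \<longrightarrow> norm z < norm y \<longrightarrow> \<bar>F x\<bar> \<le> \<bar>F z\<bar>)"

definition minor :: "(real^3 \<Rightarrow> real) \<Rightarrow> (real^3 \<Rightarrow> real) \<Rightarrow> real^3 \<Rightarrow> real^3 \<Rightarrow> real" where
  "minor F Q x y = F x * Q y - F y * Q x"

text \<open>On a line through the origin \<open>\<bar>F\<bar>\<close> is proportional to the norm,
  whereas from \<open>x\<close> to \<open>y\<close> the norm grows and \<open>\<bar>F\<bar>\<close>
  falls.\<close>

lemma consecutive_independent:
  assumes "consecutive F x y" "linear F" "a *\<^sub>R x + b *\<^sub>R y = 0"
  shows "a = 0" "b = 0"
proof -
  have xy: "x \<noteq> 0" "norm x < norm y" "\<bar>F y\<bar> < \<bar>F x\<bar>"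
    using assms(1) by (auto simp: consecutive_def)
  have "a *\<^sub>R x = - (b *\<^sub>R y)"
    using assms(3) by (simp add: add_eq_0_iff2)
  then have "norm (a *\<^sub>R x) = norm (b *\<^sub>R y)" "\<bar>F (a *\<^sub>R x)\<bar> = \<bar>F (b *\<^sub>R y)\<bar>"
    using linear_neg[OF assms(2)] by simp_all
  then have 1: "\<bar>a\<bar> * norm x = \<bar>b\<bar> * norm y" and 2: "\<bar>a\<bar> * \<bar>F x\<bar> = \<bar>b\<bar> * \<bar>F y\<bar>"
    using linear_scale[OF assms(2)] by (simp_all add: abs_mult)
  show b: "b = 0"
  proof (rule ccontr)
    assume b: "b \<noteq> 0"
    then have "\<bar>a\<bar> * norm x > \<bar>b\<bar> * norm x"
      using 1 xy by simp
    then have "\<bar>b\<bar> < \<bar>a\<bar>"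
      using xy by (simp add: mult_less_cancel_right)
    then have "\<bar>b\<bar> * \<bar>F y\<bar> < \<bar>a\<bar> * \<bar>F x\<bar>"
      using xy b by (intro mult_strict_mono) auto
    with 2 show False by simp
  qed
  with 1 xy show "a = 0" by simp
qed

text \<open>Rounding both coefficients to nearest integers leaves an integer point \<open>r\<close>
  with coefficients at most 1/2 in size. It is shorter than \<open>y\<close> and has a smaller value
  of \<open>F\<close> than \<open>x\<close>, so minimality forces it to vanish.\<close>

lemma consecutive_basis:
  assumes xy: "consecutive F x y" and F: "linear F" and z: "a *\<^sub>R x + b *\<^sub>R y \<in> int_points"
  shows "a \<in> \<int>" "b \<in> \<int>"
proof -
  have int: "x \<in> int_points" "y \<in> int_points" and norm: "norm x < norm y" and less: "\<bar>F y\<bar> < \<bar>F x\<bar>"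
    and min: "\<And>z. z \<in> int_points \<Longrightarrow> z \<noteq> 0 \<Longrightarrow> norm z < norm y \<Longrightarrow> \<bar>F x\<bar> \<le> \<bar>F z\<bar>"
    using xy by (auto simp: consecutive_def)
  define a' b' where "a' = a - of_int (round a)" and "b' = b - of_int (round b)"
  have half: "\<bar>a'\<bar> \<le> 1/2" "\<bar>b'\<bar> \<le> 1/2"
    using of_int_round_abs_le[of a] of_int_round_abs_le[of b]
    by (simp_all add: a'_def b'_def abs_minus_commute)
  define r where "r = a' *\<^sub>R x + b' *\<^sub>R y"
  have "r = (a *\<^sub>R x + b *\<^sub>R y) - of_int (round a) *\<^sub>R x - of_int (round b) *\<^sub>R y"
    by (simp add: r_def a'_def b'_def algebra_simps)
  then have r: "r \<in> int_points"
    using z int by (simp only:) (intro int_points_diff int_points_scaleR Ints_of_int)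
  have "norm r \<le> \<bar>a'\<bar> * norm x + \<bar>b'\<bar> * norm y"
    unfolding r_def by (rule order.trans[OF norm_triangle_ineq]) simp
  also have "\<dots> \<le> 1/2 * norm x + 1/2 * norm y"
    using half by (intro add_mono mult_right_mono) auto
  also have "\<dots> < norm y" using norm by simp
  finally have r_small: "norm r < norm y" .
  have "\<bar>F r\<bar> \<le> \<bar>a'\<bar> * \<bar>F x\<bar> + \<bar>b'\<bar> * \<bar>F y\<bar>"
    unfolding r_def linear_add[OF F] linear_scale[OF F]
    by (rule order.trans[OF abs_triangle_ineq]) (simp add: abs_mult)
  also have "\<dots> \<le> 1/2 * \<bar>F x\<bar> + 1/2 * \<bar>F y\<bar>"
    using half by (intro add_mono mult_right_mono) auto
  also have "\<dots> < \<bar>F x\<bar>" using less by simp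
  finally have "r = 0"
    using min[OF r _ r_small] by fastforce
  then have "a' = 0" "b' = 0"
    using consecutive_independent[OF xy F] by (auto simp: r_def)
  then have "a = of_int (round a)" "b = of_int (round b)"
    by (simp_all add: a'_def b'_def)
  then show "a \<in> \<int>" "b \<in> \<int>"
    by (metis Ints_of_int)+
qed

text \<open>With \<open>w = cross3 x y\<close> orthogonal to \<open>z\<close>, Lagrange's identity
  gives \<open>(w \<bullet> w) *\<^sub>R z = cross3 w (cross3 z w)\<close>. Expanding the inner and
  then the outer product leaves only multiples of \<open>x\<close> and \<open>y\<close>.\<close>

lemma coplanar_combination:
  fixes x y z :: "real^3"
  assumes w: "cross3 x y \<noteq> 0" and z: "z \<bullet> cross3 x y = 0"
  obtains a b where "z = a *\<^sub>R x + b *\<^sub>R y"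
proof -
  define w where "w = cross3 x y"
  have wx: "cross3 w x = (x \<bullet> x) *\<^sub>R y - (x \<bullet> y) *\<^sub>R x" and wy: "cross3 w y = (x \<bullet> y) *\<^sub>R y - (y \<bullet> y) *\<^sub>R x"
    using cross_skew[of w x] cross_skew[of w y] by (simp_all add: w_def Lagrange inner_commute)
  have "(w \<bullet> w) *\<^sub>R z = cross3 w (cross3 z w)"
    using z Lagrange[of w z w] by (simp add: w_def inner_commute)
  also have "cross3 z w = (z \<bullet> y) *\<^sub>R x - (z \<bullet> x) *\<^sub>R y"
    by (simp add: w_def Lagrange)
  also have "cross3 w \<dots> = (z \<bullet> y) *\<^sub>R cross3 w x - (z \<bullet> x) *\<^sub>R cross3 w y"
    by (simp add: Cross3.right_diff_distrib cross_mult_right)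
  also have "\<dots> = ((z \<bullet> x) * (y \<bullet> y) - (z \<bullet> y) * (x \<bullet> y)) *\<^sub>R x
      + ((z \<bullet> y) * (x \<bullet> x) - (z \<bullet> x) * (x \<bullet> y)) *\<^sub>R y"
    by (simp add: wx wy algebra_simps)
  finally have "(1 / (w \<bullet> w)) *\<^sub>R (w \<bullet> w) *\<^sub>R z = (1 / (w \<bullet> w)) *\<^sub>R \<dots>" by (rule arg_cong)
  moreover have "(1 / (w \<bullet> w)) *\<^sub>R (w \<bullet> w) *\<^sub>R z = z" using w by (simp add: w_def)
  ultimately have "(1 / (w \<bullet> w) * ((z \<bullet> x) * (y \<bullet> y) - (z \<bullet> y) * (x \<bullet> y))) *\<^sub>R x
      + (1 / (w \<bullet> w) * ((z \<bullet> y) * (x \<bullet> x) - (z \<bullet> x) * (x \<bullet> y))) *\<^sub>R y = z"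
    by (simp only: scaleR_add_right scaleR_scaleR)
  then show ?thesis by (rule that[OF sym])
qed

text \<open>Writing \<open>z = a *\<^sub>R x + b *\<^sub>R y\<close> multiplies the minor by
  \<open>- a\<close>. The coefficient \<open>a\<close> is an integer by the basis property and
  nonzero because \<open>y\<close> and \<open>z\<close> are independent.\<close>

lemma minor_mono_of_coplanar:
  assumes xy: "consecutive F x y" and yz: "consecutive F y z"
    and F: "linear F" and Q: "linear Q" and det: "z \<bullet> cross3 x y = 0"
  shows "\<bar>minor F Q x y\<bar> \<le> \<bar>minor F Q y z\<bar>"
proof -
  have "cross3 x y \<noteq> 0"
  proof
    assume "cross3 x y = 0"
    then have "collinear {0, x, y}" by (simp add: cross_eq_0)
    then obtain c where "x = 0 \<or> y = 0 \<or> y = c *\<^sub>R x" unfolding collinear_lemma by auto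
    then consider "1 *\<^sub>R x + 0 *\<^sub>R y = 0" | "0 *\<^sub>R x + 1 *\<^sub>R y = 0" | "(- c) *\<^sub>R x + 1 *\<^sub>R y = 0"
      by auto
    then show False
    proof cases
      case 1 from consecutive_independent(1)[OF xy F 1] show False by simp
    next
      case 2 from consecutive_independent(2)[OF xy F 2] show False by simp
    next
      case 3 from consecutive_independent(2)[OF xy F 3] show False by simp
    qed
  qed
  then obtain a b where zab: "z = a *\<^sub>R x + b *\<^sub>R y"
    using coplanar_combination det by metis
  have "a \<in> \<int>"
    using consecutive_basis(1)[OF xy F, of a b] yz unfolding zab[symmetric] by (simp add: consecutive_def)
  moreover have "a \<noteq> 0"
  proof
    assume "a = 0"
    then have "b *\<^sub>R y + (-1) *\<^sub>R z = 0" using zab by simp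
    from consecutive_independent(2)[OF yz F this] show False by simp
  qed
  ultimately have "1 \<le> \<bar>a\<bar>" by (rule Ints_abs_ge_1)
  have "minor F Q y z = - a * minor F Q x y"
    by (simp add: zab minor_def linear_add[OF F] linear_add[OF Q] linear_scale[OF F] linear_scale[OF Q] algebra_simps)
  then have "\<bar>minor F Q y z\<bar> = \<bar>a\<bar> * \<bar>minor F Q x y\<bar>" by (simp add: abs_mult)
  then show ?thesis
    using mult_right_mono[OF \<open>1 \<le> \<bar>a\<bar>\<close>, of "\<bar>minor F Q x y\<bar>"] by simp
qed

lemma exists_consecutive_sequence:
  assumes nz: "\<And>z. z \<in> int_points \<Longrightarrow> z \<noteq> 0 \<Longrightarrow> F z \<noteq> 0"
    and small: "\<And>e. 0 < e \<Longrightarrow> \<exists>z\<in>int_points. z \<noteq> 0 \<and> \<bar>F z\<bar> < e"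
  obtains x where "\<And>n. consecutive F (x n) (x (Suc n))"
proof -
  define minimal where "minimal x \<longleftrightarrow> x \<in> int_points \<and> x \<noteq> 0 \<and>
    (\<forall>z\<in>int_points. z \<noteq> 0 \<longrightarrow> norm z \<le> norm x \<longrightarrow> \<bar>F x\<bar> \<le> \<bar>F z\<bar>)" for x
  have ex: "\<exists>y. minimal y \<and> \<bar>F y\<bar> < e \<and> (\<forall>z\<in>int_points. z \<noteq> 0 \<longrightarrow> norm z < norm y \<longrightarrow> e \<le> \<bar>F z\<bar>)"
    if "0 < e" for e
  proof -
    define A where "A = {z \<in> int_points. z \<noteq> 0 \<and> \<bar>F z\<bar> < e}"
    obtain z0 where z0: "z0 \<in> A" using small[OF \<open>0 < e\<close>] by (auto simp: A_def)
    \<comment> \<open>Cutting off at the norm of one known element makes the set finite without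
      losing the shortest elements of \<open>A\<close>.\<close>
    define A0 where "A0 = {z \<in> A. norm z \<le> norm z0}"
    have "finite A0"
      by (rule finite_subset[OF _ finite_int_points_le[of "norm z0"]]) (auto simp: A0_def A_def)
    define r where "r = Min (norm ` A0)"
    have "A0 \<noteq> {}" using z0 by (auto simp: A0_def)
    then have "r \<in> norm ` A0" unfolding r_def using \<open>finite A0\<close> by (intro Min_in) auto
    have r_le: "r \<le> norm z" if "z \<in> A" for z
    proof (cases "norm z \<le> norm z0")
      case True
      then show ?thesis unfolding r_def using \<open>finite A0\<close> that by (intro Min_le) (auto simp: A0_def)
    next
      case False
      moreover have "r \<le> norm z0" using \<open>r \<in> norm ` A0\<close> by (auto simp: A0_def)
      ultimately show ?thesis by linarith
    qed
    \<comment> \<open>Several points may share the least norm; taking one with least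
      \<open>\<bar>F\<bar>\<close> among them makes it minimal in the closed ball, as
      \<open>minimal\<close> demands.\<close>
    define A1 where "A1 = {z \<in> A0. norm z = r}"
    have "finite A1" "A1 \<noteq> {}" using \<open>finite A0\<close> \<open>r \<in> norm ` A0\<close> by (auto simp: A1_def)
    then obtain y where y: "y \<in> A1" "\<And>z. z \<in> A1 \<Longrightarrow> \<bar>F y\<bar> \<le> \<bar>F z\<bar>"
      using ex_is_arg_min_if_finite[of A1 "\<lambda>z. \<bar>F z\<bar>"] by (auto simp: is_arg_min_def not_less)
    have yA: "y \<in> A" "norm y = r" using y(1) by (auto simp: A1_def A0_def)
    have low: "e \<le> \<bar>F z\<bar>" if "z \<in> int_points" "z \<noteq> 0" "norm z < norm y" for z
      using r_le[of z] that yA by (force simp: A_def)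
    have "\<bar>F y\<bar> \<le> \<bar>F z\<bar>" if z: "z \<in> int_points" "z \<noteq> 0" "norm z \<le> norm y" for z
    proof (cases "\<bar>F z\<bar> < e")
      case True
      then have "z \<in> A" using z by (simp add: A_def)
      with r_le[of z] z yA y(1) have "z \<in> A1" by (auto simp: A1_def A0_def)
      then show ?thesis by (rule y)
    next
      case False
      then show ?thesis using yA by (simp add: A_def)
    qed
    then show ?thesis
      using yA low by (intro exI[of _ y]) (auto simp: minimal_def A_def)
  qed
  have "\<exists>x. \<forall>n. minimal (x n) \<and> consecutive F (x n) (x (Suc n))"
  proof (rule dependent_nat_choice)
    show "\<exists>x. minimal x" using ex[of 1] by auto
  next
    fix x n assume x: "minimal x"
    then have "0 < \<bar>F x\<bar>" using nz by (simp add: minimal_def)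
    from ex[OF this] obtain y where y: "minimal y" "\<bar>F y\<bar> < \<bar>F x\<bar>"
      "\<forall>z\<in>int_points. z \<noteq> 0 \<longrightarrow> norm z < norm y \<longrightarrow> \<bar>F x\<bar> \<le> \<bar>F z\<bar>" by blast
    have "norm x < norm y"
    proof (rule ccontr)
      assume "\<not> norm x < norm y"
      with x y(1) have "\<bar>F x\<bar> \<le> \<bar>F y\<bar>" by (simp add: minimal_def)
      with y(2) show False by simp
    qed
    then show "\<exists>y. minimal y \<and> consecutive F x y"
      using x y by (auto simp: minimal_def consecutive_def)
  qed
  then show ?thesis using that by blast
qed

text \<open>Strictly increasing norms make the sequence injective, and a ball contains only finitely
  many integer points.\<close>

lemma consecutive_norm_at_top:
  assumes "\<And>n. consecutive F (x n) (x (Suc n))"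
  shows "filterlim (\<lambda>n. norm (x n)) at_top sequentially"
proof -
  have sm: "strict_mono (\<lambda>n. norm (x n))"
    using assms by (simp add: strict_mono_Suc_iff consecutive_def)
  have "\<exists>n. r \<le> norm (x n)" for r
  proof (rule ccontr)
    assume "\<nexists>n. r \<le> norm (x n)"
    then have "range x \<subseteq> {x \<in> int_points. norm x \<le> r}"
      using assms by (auto simp: consecutive_def not_le less_imp_le)
    then have "finite (range x)" by (rule finite_subset[OF _ finite_int_points_le])
    moreover have "inj (\<lambda>n. norm (x n))" by (rule strict_mono_imp_inj_on[OF sm])
    then have "inj x" by (auto simp: inj_def)
    ultimately show False using finite_imageD by blast
  qed
  moreover have "norm (x m) \<le> norm (x n)" if "m \<le> n" for m n
    using monoD[OF strict_mono_mono[OF sm] that] .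
  ultimately show ?thesis
    unfolding filterlim_at_top eventually_sequentially by (meson order.trans)
qed

section \<open>Determinants built from two linear forms and a coordinate\<close>

section \<open>Pairs of linear forms\<close>

lemma linear_lin_form: "linear (lin_form a b c)"
  by (rule linearI) (simp_all add: lin_form_def algebra_simps)

lemma abs_lin_form_le: "\<bar>lin_form a b c x\<bar> \<le> (\<bar>a\<bar> + \<bar>b\<bar> + \<bar>c\<bar>) * norm x"
proof -
  have "\<bar>lin_form a b c x\<bar> \<le> \<bar>a\<bar> * \<bar>x $ 1\<bar> + \<bar>b\<bar> * \<bar>x $ 2\<bar> + \<bar>c\<bar> * \<bar>x $ 3\<bar>"
    unfolding lin_form_def abs_mult[symmetric] by linarith
  also have "\<dots> \<le> \<bar>a\<bar> * norm x + \<bar>b\<bar> * norm x + \<bar>c\<bar> * norm x"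
    by (intro add_mono mult_left_mono component_le_norm_cart) auto
  finally show ?thesis by (simp add: algebra_simps)
qed

lemma lin_indep_forms_coeffs:
  assumes "lin_indep_forms (lin_form a b c) (lin_form p q r)"
  shows "cross3 (vector [a, b, c]) (vector [p, q, r]) \<noteq> 0"
proof
  assume 0: "cross3 (vector [a, b, c]) (vector [p, q, r]) = 0"
  then have eqs: "b * r = c * q" "c * p = a * r" "a * q = b * p"
    by (simp_all add: cross3_def vec_eq_iff forall_3)
  have ind: "u = 0 \<and> v = 0" if "\<And>x. u * lin_form a b c x + v * lin_form p q r x = 0" for u v
    using assms that unfolding lin_indep_forms_def by blast
  \<comment> \<open>Proportional coefficient vectors give three relations between the forms.
    Independence then kills \<open>a\<close>, \<open>b\<close> and \<open>c\<close>, so the first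
    form is zero, which is itself a dependence.\<close>
  have "p * lin_form a b c x + (- a) * lin_form p q r x = 0"
    "q * lin_form a b c x + (- b) * lin_form p q r x = 0"
    "r * lin_form a b c x + (- c) * lin_form p q r x = 0" for x
  proof -
    have "p * lin_form a b c x + (- a) * lin_form p q r x = x $ 2 * (b * p - a * q) + x $ 3 * (c * p - a * r)"
      "q * lin_form a b c x + (- b) * lin_form p q r x = x $ 1 * (a * q - b * p) + x $ 3 * (c * q - b * r)"
      "r * lin_form a b c x + (- c) * lin_form p q r x = x $ 1 * (a * r - c * p) + x $ 2 * (b * r - c * q)"
      by (simp_all add: lin_form_def algebra_simps)
    with eqs show "p * lin_form a b c x + (- a) * lin_form p q r x = 0"
      "q * lin_form a b c x + (- b) * lin_form p q r x = 0"
      "r * lin_form a b c x + (- c) * lin_form p q r x = 0"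
      by simp_all
  qed
  from ind[OF this(1)] ind[OF this(2)] ind[OF this(3)] have "lin_form a b c x = 0" for x
    by (simp add: lin_form_def)
  then show False using ind[of 1 0] by simp
qed

text \<open>Multiplicativity of the determinant: the matrix with rows the two coefficient vectors
  and the \<open>i\<close>-th unit vector is multiplied by the matrix with columns \<open>x\<close>,
  \<open>y\<close>, \<open>z\<close>. The right side expands the product along its first
  row.\<close>

lemma triple_product_expansion:
  "cross3 (vector [a, b, c]) (vector [p, q, r]) $ i * (z \<bullet> cross3 x y) =
     lin_form a b c x * (lin_form p q r y * z $ i - lin_form p q r z * y $ i)
   - lin_form a b c y * (lin_form p q r x * z $ i - lin_form p q r z * x $ i)
   + lin_form a b c z * (lin_form p q r x * y $ i - lin_form p q r y * x $ i)"
proof -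
  have "\<forall>i. cross3 (vector [a, b, c]) (vector [p, q, r]) $ i * (z \<bullet> cross3 x y) =
     lin_form a b c x * (lin_form p q r y * z $ i - lin_form p q r z * y $ i)
   - lin_form a b c y * (lin_form p q r x * z $ i - lin_form p q r z * x $ i)
   + lin_form a b c z * (lin_form p q r x * y $ i - lin_form p q r y * x $ i)"
    unfolding forall_3 by (simp add: lin_form_def cross3_def inner_vec_def sum_3 algebra_simps)
  then show ?thesis by blast
qed

text \<open>The triple product is a nonzero integer, hence at least 1 in absolute value. Some
  component of the cross product of the coefficient vectors is nonzero, and \<open>K\<close> is the
  inverse of its absolute value.\<close>

lemma triple_product_lower_bound:
  assumes "lin_indep_forms (lin_form a b c) (lin_form p q r)"
  obtains K where "0 < K" and
    "\<And>x y z. x \<in> int_points \<Longrightarrow> y \<in> int_points \<Longrightarrow> z \<in> int_points \<Longrightarrow> z \<bullet> cross3 x y \<noteq> 0 \<Longrightarrow>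
      1 \<le> K * (\<bar>lin_form a b c x\<bar> * (\<bar>lin_form p q r y\<bar> * norm z + \<bar>lin_form p q r z\<bar> * norm y)
           + \<bar>lin_form a b c y\<bar> * (\<bar>lin_form p q r x\<bar> * norm z + \<bar>lin_form p q r z\<bar> * norm x)
           + \<bar>lin_form a b c z\<bar> * (\<bar>lin_form p q r x\<bar> * norm y + \<bar>lin_form p q r y\<bar> * norm x))"
proof -
  let ?n = "cross3 (vector [a, b, c]) (vector [p, q, r]) :: real^3"
  obtain i where i: "?n $ i \<noteq> 0"
    using lin_indep_forms_coeffs[OF assms] by (auto simp: vec_eq_iff)
  let ?L = "lin_form a b c" and ?P = "lin_form p q r"
  have key: "1 \<le> 1 / \<bar>?n $ i\<bar> * (\<bar>?L x\<bar> * (\<bar>?P y\<bar> * norm z + \<bar>?P z\<bar> * norm y)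
           + \<bar>?L y\<bar> * (\<bar>?P x\<bar> * norm z + \<bar>?P z\<bar> * norm x)
           + \<bar>?L z\<bar> * (\<bar>?P x\<bar> * norm y + \<bar>?P y\<bar> * norm x))" (is "1 \<le> _ * ?S")
    if int: "x \<in> int_points" "y \<in> int_points" "z \<in> int_points" and det: "z \<bullet> cross3 x y \<noteq> 0" for x y z
  proof -
    have "1 \<le> \<bar>z \<bullet> cross3 x y\<bar>"
      using int det by (intro Ints_abs_ge_1 inner_int_points cross3_int_points)
    from mult_left_mono[OF this, of "\<bar>?n $ i\<bar>"] have "\<bar>?n $ i\<bar> \<le> \<bar>?n $ i * (z \<bullet> cross3 x y)\<bar>"
      by (simp add: abs_mult)
    also have "\<dots> \<le> ?S"
    proof -
      have bnd: "\<bar>u * (v * s $ i - w * t $ i)\<bar> \<le> \<bar>u\<bar> * (\<bar>v\<bar> * norm s + \<bar>w\<bar> * norm t)"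
        for u v w :: real and s t :: "real^3"
      proof -
        have "\<bar>v * s $ i - w * t $ i\<bar> \<le> \<bar>v\<bar> * \<bar>s $ i\<bar> + \<bar>w\<bar> * \<bar>t $ i\<bar>"
          unfolding abs_mult[symmetric] by (rule abs_triangle_ineq4)
        also have "\<dots> \<le> \<bar>v\<bar> * norm s + \<bar>w\<bar> * norm t"
          by (intro add_mono mult_left_mono component_le_norm_cart) auto
        finally show ?thesis by (simp add: abs_mult mult_left_mono)
      qed
      have "\<bar>s - t + u\<bar> \<le> \<bar>s\<bar> + \<bar>t\<bar> + \<bar>u\<bar>" for s t u :: real by linarith
      then show ?thesis
        unfolding triple_product_expansion by (rule order.trans) (intro add_mono bnd)
    qed
    finally have "\<bar>?n $ i\<bar> \<le> ?S" .
    then show ?thesis using i by (simp add: le_divide_eq)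
  qed
  show ?thesis
    by (rule that[of "1 / \<bar>?n $ i\<bar>"]) (use i in simp, rule key)
qed

section \<open>Uniform approximation and its effect on minimal points\<close>

section \<open>The uniform exponent\<close>

text \<open>Pigeonhole: the \<open>(N+1)^2\<close> pairs in \<open>A\<close> give fractional parts
  falling into \<open>N^2\<close> intervals of length \<open>1 / N^2\<close>, and \<open>z\<close>
  is the difference of two pairs sharing an interval. Its first coordinate is then controlled by the
  form and the other two.\<close>

lemma dirichlet_linear_form:
  fixes \<theta>\<^sub>1 \<theta>\<^sub>2 :: real and N :: nat
  assumes "0 < N"
  shows "\<exists>z\<in>int_points. z \<noteq> 0 \<and> norm z \<le> (\<bar>\<theta>\<^sub>1\<bar> + \<bar>\<theta>\<^sub>2\<bar> + 3) * N \<and> \<bar>lin_form 1 \<theta>\<^sub>1 \<theta>\<^sub>2 z\<bar> \<le> 1 / (real N)\<^sup>2"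
proof -
  define u where "u = (\<lambda>(a, b). real a * \<theta>\<^sub>1 + real b * \<theta>\<^sub>2)"
  define f where "f q = \<lfloor>frac (u q) * (real N)\<^sup>2\<rfloor>" for q
  define A where "A = {..N} \<times> {..N}"
  have N2: "0 < (real N)\<^sup>2" using assms by simp
  have "f ` A \<subseteq> {0..<int (N\<^sup>2)}"
  proof
    fix y assume "y \<in> f ` A"
    then obtain q where y: "y = f q" by blast
    have "frac (u q) * (real N)\<^sup>2 < 1 * (real N)\<^sup>2"
      using N2 by (intro mult_strict_right_mono frac_lt_1)
    then show "y \<in> {0..<int (N\<^sup>2)}"
      by (simp add: y f_def floor_less_iff)
  qed
  then have "card (f ` A) \<le> card {0..<int (N\<^sup>2)}" by (intro card_mono) auto
  also have "\<dots> < card A" by (simp add: A_def power2_eq_square nat_mult_distrib)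
  finally have "\<not> inj_on f A" by (rule pigeonhole)
  then obtain q q' where q: "q \<in> A" "q' \<in> A" "q \<noteq> q'" "f q = f q'" by (auto simp: inj_on_def)
  obtain a b a' b' where ab: "q = (a, b)" "q' = (a', b')" by (cases q, cases q')
  define z :: "real^3" where
    "z = vector [of_int (\<lfloor>u q'\<rfloor> - \<lfloor>u q\<rfloor>), of_int (int a - int a'), of_int (int b - int b')]"
  have z: "z $ 1 = of_int (\<lfloor>u q'\<rfloor> - \<lfloor>u q\<rfloor>)" "z $ 2 = of_int (int a - int a')" "z $ 3 = of_int (int b - int b')"
    by (simp_all add: z_def)
  have "lin_form 1 \<theta>\<^sub>1 \<theta>\<^sub>2 z = frac (u q) - frac (u q')"
    unfolding lin_form_def z by (simp add: frac_def ab u_def algebra_simps)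
  moreover have "\<bar>frac (u q) * (real N)\<^sup>2 - frac (u q') * (real N)\<^sup>2\<bar> < 1"
    using q(4) unfolding f_def by linarith
  then have "\<bar>frac (u q) - frac (u q')\<bar> * (real N)\<^sup>2 < 1"
    using N2 by (simp add: abs_mult flip: left_diff_distrib)
  ultimately have L: "\<bar>lin_form 1 \<theta>\<^sub>1 \<theta>\<^sub>2 z\<bar> \<le> 1 / (real N)\<^sup>2"
    using N2 by (simp add: pos_le_divide_eq)
  have "1 / (real N)\<^sup>2 \<le> real N"
  proof -
    have "1 \<le> real N" using assms by simp
    then have "1 \<le> real N * (real N)\<^sup>2" using one_le_power[of "real N" 3] by (simp add: eval_nat_numeral)
    then show ?thesis using N2 by (simp add: pos_divide_le_eq)
  qed
  have z2: "\<bar>z $ 2\<bar> \<le> N" and z3: "\<bar>z $ 3\<bar> \<le> N"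
    using q(1,2) by (auto simp: z ab A_def)
  have "z $ 1 = lin_form 1 \<theta>\<^sub>1 \<theta>\<^sub>2 z - \<theta>\<^sub>1 * z $ 2 - \<theta>\<^sub>2 * z $ 3"
    by (simp add: lin_form_def)
  then have "\<bar>z $ 1\<bar> \<le> \<bar>lin_form 1 \<theta>\<^sub>1 \<theta>\<^sub>2 z\<bar> + \<bar>\<theta>\<^sub>1 * z $ 2\<bar> + \<bar>\<theta>\<^sub>2 * z $ 3\<bar>" by linarith
  also have "\<dots> \<le> N + \<bar>\<theta>\<^sub>1\<bar> * N + \<bar>\<theta>\<^sub>2\<bar> * N"
    unfolding abs_mult using L \<open>1 / (real N)\<^sup>2 \<le> real N\<close> z2 z3
    by (intro add_mono mult_left_mono) auto
  finally have z1: "\<bar>z $ 1\<bar> \<le> N + \<bar>\<theta>\<^sub>1\<bar> * N + \<bar>\<theta>\<^sub>2\<bar> * N" .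
  have "norm z \<le> \<bar>z $ 1\<bar> + \<bar>z $ 2\<bar> + \<bar>z $ 3\<bar>"
    using norm_le_l1_cart[of z] by (simp add: sum_3)
  with z1 z2 z3 have "norm z \<le> (\<bar>\<theta>\<^sub>1\<bar> + \<bar>\<theta>\<^sub>2\<bar> + 3) * N"
    by (simp add: algebra_simps)
  moreover have "z \<noteq> 0"
  proof
    assume "z = 0"
    then have "z $ 2 = 0" "z $ 3 = 0" by simp_all
    with q(3) show False by (simp add: z ab)
  qed
  moreover have "z \<in> int_points" unfolding int_points_def forall_3 mem_Collect_eq z by simp
  ultimately show ?thesis using L by blast
qed

lemma lin_form_nonzero:
  assumes "lin_indep_int3 a b c" "z \<in> int_points" "z \<noteq> 0"
  shows "lin_form a b c z \<noteq> 0"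
proof
  assume 0: "lin_form a b c z = 0"
  have fl: "of_int \<lfloor>z $ i\<rfloor> = z $ i" for i
    using assms(2) by (auto simp: int_points_def elim: Ints_cases)
  then have "of_int \<lfloor>z $ 1\<rfloor> * a + of_int \<lfloor>z $ 2\<rfloor> * b + of_int \<lfloor>z $ 3\<rfloor> * c = 0"
    using 0 unfolding fl by (simp add: lin_form_def mult.commute)
  then have "\<lfloor>z $ 1\<rfloor> = 0" "\<lfloor>z $ 2\<rfloor> = 0" "\<lfloor>z $ 3\<rfloor> = 0"
    using assms(1) unfolding lin_indep_int3_def by blast+
  then have "z $ 1 = 0" "z $ 2 = 0" "z $ 3 = 0" using fl by (metis of_int_0)+
  with assms(3) show False by (simp add: vec_eq_iff forall_3)
qed

lemma finite_min_form_set: "finite {x \<in> int_points. 0 < norm x \<and> norm x \<le> t}"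
  by (rule finite_subset[OF _ finite_int_points_le[of t]]) auto

lemma min_form_le:
  assumes "z \<in> int_points" "z \<noteq> 0" "norm z \<le> t"
  shows "min_form F t \<le> \<bar>F z\<bar>"
  unfolding min_form_def using assms finite_min_form_set by (intro Min_le) auto

lemma min_form_ge:
  assumes "x \<in> int_points" "x \<noteq> 0" "norm x \<le> t"
    and "\<And>z. z \<in> int_points \<Longrightarrow> z \<noteq> 0 \<Longrightarrow> norm z \<le> t \<Longrightarrow> e \<le> \<bar>F z\<bar>"
  shows "e \<le> min_form F t"
  unfolding min_form_def
proof (rule Min.boundedI)
  show "finite ((\<lambda>x. \<bar>F x\<bar>) ` {x \<in> int_points. 0 < norm x \<and> norm x \<le> t})"
    using finite_min_form_set by (rule finite_imageI)
  show "(\<lambda>x. \<bar>F x\<bar>) ` {x \<in> int_points. 0 < norm x \<and> norm x \<le> t} \<noteq> {}"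
    using assms(1-3) by auto
qed (use assms(4) in auto)

definition uniform_set :: "real \<Rightarrow> real \<Rightarrow> real set" where
  "uniform_set \<theta>\<^sub>1 \<theta>\<^sub>2 =
     {\<gamma>. Limsup at_top (\<lambda>t :: real. ereal (t powr \<gamma> * min_form (lin_form 1 \<theta>\<^sub>1 \<theta>\<^sub>2) t)) < \<infinity>}"

text \<open>Dirichlet's bound is used with \<open>N\<close> the integer part of
  \<open>t / c\<close>, so that the point found has norm at most \<open>t\<close>. For
  \<open>t \<ge> 2 * c\<close> rounding down loses at most a factor 2, whence the constant
  \<open>4 * c\<^sup>2\<close>.\<close>

lemma two_in_uniform_set: "2 \<in> uniform_set \<theta>\<^sub>1 \<theta>\<^sub>2"
proof -
  define c where "c = \<bar>\<theta>\<^sub>1\<bar> + \<bar>\<theta>\<^sub>2\<bar> + 3"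
  have c: "0 < c" by (simp add: c_def)
  let ?m = "min_form (lin_form 1 \<theta>\<^sub>1 \<theta>\<^sub>2)"
  have bound: "t powr 2 * ?m t \<le> 4 * c\<^sup>2" if t: "2 * c \<le> t" for t
  proof -
    define N where "N = nat \<lfloor>t / c\<rfloor>"
    have "2 \<le> t / c" using t c by (simp add: pos_le_divide_eq)
    moreover from this have "real N = of_int \<lfloor>t / c\<rfloor>" by (simp add: N_def)
    ultimately have "t / c / 2 \<le> real N \<and> real N \<le> t / c \<and> 0 < real N"
      using floor_correct[of "t / c"] by (auto; linarith)
    then have N: "t / c / 2 \<le> real N" "real N \<le> t / c" "0 < N" by simp_all
    obtain z where z: "z \<in> int_points" "z \<noteq> 0" "norm z \<le> c * N" "\<bar>lin_form 1 \<theta>\<^sub>1 \<theta>\<^sub>2 z\<bar> \<le> 1 / (real N)\<^sup>2"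
      using dirichlet_linear_form[OF N(3)] unfolding c_def by blast
    have "c * N \<le> t" using N(2) c by (simp add: pos_le_divide_eq mult.commute)
    then have "?m t \<le> 1 / (real N)\<^sup>2"
      using min_form_le[of z t "lin_form 1 \<theta>\<^sub>1 \<theta>\<^sub>2"] z by linarith
    also have "\<dots> \<le> 1 / (t / c / 2)\<^sup>2"
      using N t c by (intro divide_left_mono power_mono mult_pos_pos zero_less_power) auto
    finally have "t powr 2 * ?m t \<le> t powr 2 * (1 / (t / c / 2)\<^sup>2)" by (intro mult_left_mono) auto
    also have "\<dots> = 4 * c\<^sup>2" using t c by (simp add: power_divide)
    finally show ?thesis .
  qed
  have "Limsup at_top (\<lambda>t :: real. ereal (t powr 2 * ?m t)) \<le> ereal (4 * c\<^sup>2)"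
    by (rule Limsup_bounded) (use bound in \<open>auto simp: eventually_at_top_linorder\<close>)
  then show ?thesis unfolding uniform_set_def using le_less_trans by fastforce
qed

lemma consecutive_uniform_bound:
  assumes \<gamma>: "\<gamma> \<in> uniform_set \<theta>\<^sub>1 \<theta>\<^sub>2" "0 \<le> \<gamma>" and x: "\<And>n. consecutive (lin_form 1 \<theta>\<^sub>1 \<theta>\<^sub>2) (x n) (x (Suc n))"
  obtains C where "0 < C"
    "\<forall>\<^sub>F n in sequentially. \<bar>lin_form 1 \<theta>\<^sub>1 \<theta>\<^sub>2 (x n)\<bar> \<le> C * norm (x (Suc n)) powr (- \<gamma>)"
proof -
  let ?L = "lin_form 1 \<theta>\<^sub>1 \<theta>\<^sub>2"
  from \<gamma>(1) obtain B where "Limsup at_top (\<lambda>t :: real. ereal (t powr \<gamma> * min_form ?L t)) < ereal B"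
    unfolding uniform_set_def mem_Collect_eq ereal_infty_less(1) less_PInf_Ex_of_nat by blast
  from Limsup_lessD[OF this] have ev: "\<forall>\<^sub>F t in at_top. t powr \<gamma> * min_form ?L t < B" by simp
  \<comment> \<open>This radius lies strictly below \<open>norm (x (Suc n))\<close>, so the minimum
    there is attained at \<open>x n\<close>. It is also at least \<open>norm (x n)\<close> and at
    least half of \<open>norm (x (Suc n))\<close>, which costs the factor
    \<open>2 powr \<gamma>\<close>.\<close>
  define s where "s n = max (norm (x n)) (norm (x (Suc n)) / 2)" for n
  have "filterlim s at_top sequentially"
    unfolding s_def by (rule filterlim_at_top_mono[OF consecutive_norm_at_top[where x = x, OF x]]) simp
  then have "\<forall>\<^sub>F n in sequentially. s n powr \<gamma> * min_form ?L (s n) < B"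
    using ev by (auto simp: filterlim_iff)
  then have "\<forall>\<^sub>F n in sequentially. \<bar>?L (x n)\<bar> \<le> (2 powr \<gamma> * max B 1) * norm (x (Suc n)) powr (- \<gamma>)"
  proof eventually_elim
    case (elim n)
    have c: "x n \<in> int_points" "x n \<noteq> 0" "norm (x n) < norm (x (Suc n))"
      "\<And>z. z \<in> int_points \<Longrightarrow> z \<noteq> 0 \<Longrightarrow> norm z < norm (x (Suc n)) \<Longrightarrow> \<bar>?L (x n)\<bar> \<le> \<bar>?L z\<bar>"
      using x[of n] by (auto simp: consecutive_def)
    have pos: "0 < norm (x (Suc n))" using c(3) norm_ge_zero[of "x n"] by linarith
    have s: "s n < norm (x (Suc n))" "norm (x n) \<le> s n" "norm (x (Suc n)) / 2 \<le> s n"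
      using c(3) pos unfolding s_def by auto
    have "\<bar>?L (x n)\<bar> \<le> min_form ?L (s n)"
      using c s by (intro min_form_ge[of "x n"]) auto
    then have "(norm (x (Suc n)) / 2) powr \<gamma> * \<bar>?L (x n)\<bar> \<le> s n powr \<gamma> * min_form ?L (s n)"
      using s \<gamma>(2) by (intro mult_mono powr_mono2) auto
    also have "\<dots> \<le> max B 1" using elim by simp
    finally show ?case using pos by (simp add: powr_divide powr_minus field_simps)
  qed
  then show ?thesis by (intro that[of "2 powr \<gamma> * max B 1"]) auto
qed

text \<open>If all triples from \<open>N\<close> on were coplanar, the minors of \<open>F\<close>
  with each coordinate could not decrease in absolute value, yet they tend to 0. So they vanish at
  \<open>N\<close>, which makes \<open>x N\<close> and \<open>x (Suc N)\<close> dependent.\<close>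

lemma infinitely_many_independent_triples:
  assumes F: "linear F" and x: "\<And>n. consecutive F (x n) (x (Suc n))"
    and small: "(\<lambda>n. \<bar>F (x n)\<bar> * norm (x (Suc n))) \<longlonglongrightarrow> 0"
  shows "\<exists>n\<ge>N. x (n + 2) \<bullet> cross3 (x n) (x (n + 1)) \<noteq> 0"
proof (rule ccontr)
  assume "\<not> ?thesis"
  then have cop: "\<And>n. n \<ge> N \<Longrightarrow> x (n + 2) \<bullet> cross3 (x n) (x (n + 1)) = 0" by blast
  have "minor F (\<lambda>z. z $ i) (x N) (x (Suc N)) = 0" for i
  proof -
    let ?M = "\<lambda>n. \<bar>minor F (\<lambda>z. z $ i) (x n) (x (Suc n))\<bar>"
    have lin: "linear (\<lambda>z :: real^3. z $ i)" by (rule linearI) simp_all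
    have M_step: "?M n \<le> ?M (Suc n)" if "n \<ge> N" for n
      using cop[OF that] by (intro minor_mono_of_coplanar[OF x x F lin]) simp
    have mono: "?M N \<le> ?M n" if "N \<le> n" for n
      using that
    proof (induction n rule: dec_induct)
      case (step n)
      from step.IH M_step[OF step.hyps(1)] show ?case by (rule order.trans)
    qed simp
    have le: "?M n \<le> 2 * (\<bar>F (x n)\<bar> * norm (x (Suc n)))" for n
    proof -
      have "?M n \<le> \<bar>F (x n)\<bar> * \<bar>x (Suc n) $ i\<bar> + \<bar>F (x (Suc n))\<bar> * \<bar>x n $ i\<bar>"
        unfolding minor_def abs_mult[symmetric] by (rule abs_triangle_ineq4)
      also have "\<dots> \<le> \<bar>F (x n)\<bar> * norm (x (Suc n)) + \<bar>F (x n)\<bar> * norm (x (Suc n))"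
        using x[of n] component_le_norm_cart[of "x n" i] component_le_norm_cart[of "x (Suc n)" i]
        by (intro add_mono mult_mono) (auto simp: consecutive_def)
      finally show ?thesis by simp
    qed
    have "(\<lambda>n. 2 * (\<bar>F (x n)\<bar> * norm (x (Suc n)))) \<longlonglongrightarrow> 2 * 0"
      by (intro tendsto_mult_left small)
    then have "?M N \<le> 2 * 0"
      by (rule tendsto_lowerbound) (use mono le order.trans in \<open>auto simp: eventually_sequentially intro!: exI[of _ N]; blast\<close>)+
    then show ?thesis by simp
  qed
  then have "(- F (x (Suc N))) *\<^sub>R x N + F (x N) *\<^sub>R x (Suc N) = 0"
    by (simp add: minor_def vec_eq_iff)
  from consecutive_independent(2)[OF x F this] x[of N] show False
    by (simp add: consecutive_def)
qed

section \<open>Application of the descent to minimal points\<close>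

lemma uniform_set_imp_infinitely_many:
  assumes ind: "lin_indep_int3 1 \<theta>\<^sub>1 \<theta>\<^sub>2" and LP: "lin_indep_forms (lin_form 1 \<theta>\<^sub>1 \<theta>\<^sub>2) (lin_form p\<^sub>0 p\<^sub>1 p\<^sub>2)"
    and \<gamma>: "\<gamma> \<in> uniform_set \<theta>\<^sub>1 \<theta>\<^sub>2" "1 < \<gamma>" and g: "0 \<le> g" "g < \<gamma>\<^sup>2 - \<gamma> + 1"
  shows "infinite {x \<in> int_points. x \<noteq> 0 \<and>
           \<bar>lin_form 1 \<theta>\<^sub>1 \<theta>\<^sub>2 x\<bar> \<le> \<bar>lin_form p\<^sub>0 p\<^sub>1 p\<^sub>2 x\<bar> * norm x powr (- g)}"
proof
  let ?L = "lin_form 1 \<theta>\<^sub>1 \<theta>\<^sub>2" and ?P = "lin_form p\<^sub>0 p\<^sub>1 p\<^sub>2"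
  let ?E = "{x \<in> int_points. x \<noteq> 0 \<and> \<bar>?L x\<bar> \<le> \<bar>?P x\<bar> * norm x powr (- g)}"
  assume "finite ?E"
  then have "bounded ?E" by (rule finite_imp_bounded)
  \<comment> \<open>Beyond norm \<open>R\<close> the reverse inequality between L and P holds, which
    is the hypothesis \<open>small\<close> of the descent.\<close>
  then obtain R where R: "\<And>x. x \<in> ?E \<Longrightarrow> norm x \<le> R" unfolding bounded_iff by blast
  have "\<exists>z\<in>int_points. z \<noteq> 0 \<and> \<bar>?L z\<bar> < e" if e: "0 < e" for e
  proof -
    obtain n where "inverse (of_nat (Suc n)) < e" using reals_Archimedean[OF e] by blast
    then obtain N :: nat where N: "0 < N" "1 / real N < e" by (metis inverse_eq_divide zero_less_Suc)
    have "1 / (real N)\<^sup>2 \<le> 1 / real N"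
      using N by (intro divide_left_mono) (auto simp: power2_eq_square)
    then show ?thesis
      using dirichlet_linear_form[OF N(1), of \<theta>\<^sub>1 \<theta>\<^sub>2] N(2) by fastforce
  qed
  then obtain x where x: "\<And>n. consecutive ?L (x n) (x (Suc n))"
    using exists_consecutive_sequence[of ?L] lin_form_nonzero[OF ind] by metis
  have xi: "x n \<in> int_points" "x n \<noteq> 0" for n using x[of n] by (auto simp: consecutive_def)
  define X where "X n = norm (x n)" for n
  define l where "l n = \<bar>?L (x n)\<bar>" for n
  define p where "p n = \<bar>?P (x n)\<bar>" for n
  define S where "S n \<longleftrightarrow> x (n + 2) \<bullet> cross3 (x n) (x (n + 1)) \<noteq> 0" for n
  define m where "m n = \<bar>minor ?L ?P (x n) (x (Suc n))\<bar>" for n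
  have X1: "1 \<le> X n" for n unfolding X_def using norm_int_points_ge_1 xi .
  have Xmono: "X n < X (Suc n)" and lmono: "l (Suc n) < l n" for n
    using x[of n] by (auto simp: consecutive_def X_def l_def)
  have lpos: "0 < l n" for n using lin_form_nonzero[OF ind xi] by (simp add: l_def)
  have Xlim: "filterlim X at_top sequentially"
    unfolding X_def by (rule consecutive_norm_at_top[where x = x, OF x])
  obtain C where C: "0 < C" "\<forall>\<^sub>F n in sequentially. l n \<le> C * X (Suc n) powr (- \<gamma>)"
    using consecutive_uniform_bound[where x = x, OF \<gamma>(1) _ x] \<gamma>(2) unfolding l_def X_def by auto
  have "\<forall>\<^sub>F n in sequentially. R < X n"
    using Xlim unfolding filterlim_at_top_dense by blast
  then have small: "\<forall>\<^sub>F n in sequentially. p n \<le> l n * X n powr g"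
  proof eventually_elim
    case (elim n)
    then have "x n \<notin> ?E" using R[of "x n"] by (auto simp: X_def)
    then have "p n * X n powr (- g) < l n" using xi[of n] by (simp add: p_def X_def l_def)
    then show ?case using X1[of n] by (simp add: powr_minus field_simps)
  qed
  \<comment> \<open>The product is at most a multiple of \<open>X (Suc n)\<close> to the power 1 -
    \<gamma>, and \<gamma> > 1.\<close>
  have tend: "(\<lambda>n. l n * X (Suc n)) \<longlonglongrightarrow> 0"
  proof (rule tendsto_sandwich)
    show "\<forall>\<^sub>F n in sequentially. 0 \<le> l n * X (Suc n)"
      by (simp add: l_def X_def)
    show "\<forall>\<^sub>F n in sequentially. l n * X (Suc n) \<le> C * X (Suc n) powr (- (\<gamma> - 1))"
      using C(2)
    proof eventually_elim
      case (elim n)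
      from mult_right_mono[OF elim, of "X (Suc n)"] X1[of "Suc n"]
      have "l n * X (Suc n) \<le> C * (X (Suc n) powr (- \<gamma>) * X (Suc n) powr 1)" by simp
      then show ?case unfolding powr_add[symmetric] by simp
    qed
    have "(\<lambda>n. X (Suc n) powr (- (\<gamma> - 1))) \<longlonglongrightarrow> 0"
      using \<gamma>(2) Xlim by (intro tendsto_neg_powr) (auto simp: filterlim_sequentially_Suc)
    then show "(\<lambda>n. C * X (Suc n) powr (- (\<gamma> - 1))) \<longlonglongrightarrow> 0"
      by (rule tendsto_mult_right_zero)
  qed simp
  have Sinf: "\<exists>n\<ge>N. S n" for N
    unfolding S_def by (rule infinitely_many_independent_triples[where x = x, OF linear_lin_form x])
      (use tend in \<open>simp add: l_def X_def\<close>)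
  obtain K where K: "0 < K" and det: "\<And>n. S n \<Longrightarrow> 1 \<le> K * (l n * (p (n+1) * X (n+2) + p (n+2) * X (n+1))
              + l (n+1) * (p n * X (n+2) + p (n+2) * X n)
              + l (n+2) * (p n * X (n+1) + p (n+1) * X n))"
    using triple_product_lower_bound[OF LP] xi unfolding S_def l_def p_def X_def by metis
  show False
  proof (rule large_determinants_contradiction[where m = m and B = "\<bar>p\<^sub>0\<bar> + \<bar>p\<^sub>1\<bar> + \<bar>p\<^sub>2\<bar> + 1" and S = S,
        OF X1 Xmono Xlim lpos lmono C(1) K _ \<gamma>(2) g C(2) _ _ small Sinf det])
    show "p n \<le> (\<bar>p\<^sub>0\<bar> + \<bar>p\<^sub>1\<bar> + \<bar>p\<^sub>2\<bar> + 1) * X n" for n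
      using abs_lin_form_le[of p\<^sub>0 p\<^sub>1 p\<^sub>2 "x n"] X1[of n] by (simp add: p_def X_def distrib_right)
    show "l n * p (n + 1) - l (n + 1) * p n \<le> m n" for n
      unfolding l_def p_def m_def minor_def abs_mult[symmetric] using abs_triangle_ineq2 by simp
    show "m n \<le> l n * p (n + 1) + l (n + 1) * p n" for n
      unfolding l_def p_def m_def minor_def abs_mult[symmetric] using abs_triangle_ineq4 by simp
    show "m n \<le> m (Suc n)" if "\<not> S n" for n
      using that unfolding m_def S_def by (intro minor_mono_of_coplanar[OF x x linear_lin_form linear_lin_form]) simp
  qed (auto simp: p_def)
qed

section \<open>Passage from admissible exponents to the suprema\<close>

theorem theorem1:
  fixes \<theta>\<^sub>1 \<theta>\<^sub>2 p\<^sub>0 p\<^sub>1 p\<^sub>2 :: real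
    and L P :: "real^3 \<Rightarrow> real"
    and \<omega> :: ereal
  defines "L \<equiv> lin_form 1 \<theta>\<^sub>1 \<theta>\<^sub>2"
    and "P \<equiv> lin_form p\<^sub>0 p\<^sub>1 p\<^sub>2"
    and "\<omega> \<equiv> uniform_exponent \<theta>\<^sub>1 \<theta>\<^sub>2"
  assumes "lin_indep_int3 1 \<theta>\<^sub>1 \<theta>\<^sub>2"
    and "lin_indep_forms L P"
  shows "omega_LP L P \<ge> (if \<omega> = \<infinity> then \<infinity> else \<omega>\<^sup>2 - \<omega> + 1)"
proof -
  have \<omega>: "\<omega> = Sup (ereal ` uniform_set \<theta>\<^sub>1 \<theta>\<^sub>2)"
    by (simp add: \<omega>_def uniform_exponent_def uniform_set_def)
  have above: "\<exists>\<gamma>\<in>uniform_set \<theta>\<^sub>1 \<theta>\<^sub>2. s < \<gamma>" if "ereal s < \<omega>" for s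
    using that unfolding \<omega> less_Sup_iff by auto
  have lower: "ereal g \<le> omega_LP L P"
    if s: "ereal s < \<omega>" "1 \<le> s" "g \<le> s\<^sup>2 - s + 1" for g s
  proof -
    obtain \<gamma> where \<gamma>: "\<gamma> \<in> uniform_set \<theta>\<^sub>1 \<theta>\<^sub>2" "s < \<gamma>" using above[OF s(1)] by blast
    have "0 \<le> s * (s - 1)" using s(2) by simp
    moreover have "s * (s - 1) < \<gamma> * (\<gamma> - 1)" using \<gamma>(2) s(2) by (intro mult_strict_mono) auto
    \<comment> \<open>The polynomial s * (s - 1) is strictly increasing for s at least 1. Replacing
      \<open>g\<close> by \<open>max g 0\<close> meets the sign condition of the preceding
      lemma.\<close>
    ultimately have "max g 0 < \<gamma>\<^sup>2 - \<gamma> + 1"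
      using s(3) by (simp add: power2_eq_square algebra_simps)
    with \<gamma> s(2) have "max g 0 \<in> {g. infinite {x \<in> int_points. x \<noteq> 0 \<and> \<bar>L x\<bar> \<le> \<bar>P x\<bar> * norm x powr (- g)}}"
      using uniform_set_imp_infinitely_many[OF assms(4) assms(5)[unfolded L_def P_def] \<gamma>(1), of "max g 0"]
      by (simp add: L_def P_def)
    then have "ereal (max g 0) \<le> omega_LP L P"
      unfolding omega_LP_def by (intro Sup_upper imageI)
    then show ?thesis by (rule order.trans[rotated]) simp
  qed
  have two: "2 \<le> \<omega>"
    using Sup_upper[of "ereal 2"] two_in_uniform_set unfolding \<omega> by (metis imageI numeral_eq_ereal)
  show ?thesis
  proof (cases \<omega>)
    case (real r)
    with two have r: "2 \<le> r" by simp
    have "ereal (r\<^sup>2 - r + 1) \<le> omega_LP L P"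
    proof (rule dense_le)
      fix y assume y: "y < ereal (r\<^sup>2 - r + 1)"
      show "y \<le> omega_LP L P"
      proof (cases y)
        case (real g)
        \<comment> \<open>The supremum need not be attained, so values \<open>s\<close> slightly
          below \<open>r\<close> are used, and continuity keeps the polynomial above
          \<open>g\<close>.\<close>
        have "((\<lambda>s. s\<^sup>2 - s + 1) \<longlongrightarrow> r\<^sup>2 - r + 1) (at_left r)" by (intro tendsto_intros)
        then have "\<forall>\<^sub>F s in at_left r. g < s\<^sup>2 - s + 1"
          using y real by (intro order_tendstoD) auto
        moreover have "\<forall>\<^sub>F s in at_left r. s \<in> {1<..<r}"
          using r by (intro eventually_at_leftI) auto
        ultimately have "\<forall>\<^sub>F s in at_left r. g < s\<^sup>2 - s + 1 \<and> s \<in> {1<..<r}"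
          by (rule eventually_conj)
        then obtain s where "g < s\<^sup>2 - s + 1" "s \<in> {1<..<r}"
          using eventually_happens'[OF trivial_limit_at_left_real] by blast
        then show ?thesis using lower[of s g] \<open>\<omega> = ereal r\<close> real by simp
      qed (use y in auto)
    qed
    then show ?thesis using real by (simp add: power2_eq_square one_ereal_def)
  next
    case PInf
    have "ereal B \<le> omega_LP L P" for B
    proof -
      define s where "s = max 1 B"
      \<comment> \<open>Expanding the square shows that the polynomial at \<open>s\<close> is at
        least \<open>s\<close>, so it exceeds every bound.\<close>
      have "0 \<le> (s - 1)\<^sup>2" by simp
      then have "s \<le> s\<^sup>2 - s + 1" by (simp add: power2_eq_square algebra_simps)
      moreover have "1 \<le> s" "B \<le> s" by (simp_all add: s_def)
      ultimately show ?thesis using lower[of s B] PInf by simp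
    qed
    then have "omega_LP L P = \<infinity>" by (rule ereal_top)
    then show ?thesis by simp
  next
    case MInf
    with two show ?thesis by simp
  qed
qed

end
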